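(* Let $g_{p,1},\dots,g_{p,n_g}$ be constraint functions, $\mathcal{I}$ the input box, $(\mathbf{u}_k)_{k\ge0}$ the iterates and $(\mathbf{u}^*_{k+1})_{k\ge0}$ the targets of an RTO scheme, as described in the context. Suppose that at every iteration $k$ the filter gain is chosen as $$K_k=\min_{j=1,\dots,n_g}\left[\frac{-g_{p,j}(\mathbf{u}_k)}{\sum_{i=1}^{n_u}\kappa_{ji}\,|u^*_{k+1,i}-u_{k,i}|}\right].$$ Let $\epsilon_j>0$ and $\delta_{g,j}>0$, $j=1,\dots,n_g$, and suppose that at every iteration $k$ $$\nabla g_{p,j}(\mathbf{u}_k)^T(\mathbf{u}^*_{k+1}-\mathbf{u}_k)\le-\delta_{g,j}\qquad\forall j: g_{p,j}(\mathbf{u}_k)\ge-\epsilon_j .$$ Then $$K_k>\min_{j=1,\dots,n_g}\left[\frac{\min\left((1-\gamma_\kappa)\epsilon_j,\ (1-\gamma_\kappa)\dfrac{K_{\epsilon,j}\,\delta_{g,j}}{\gamma_\kappa},\ -g_{p,j}(\mathbf{u}_0)\right)}{\boldsymbol{\kappa}_j^T(\mathbf{u}^U-\mathbf{u}^L)}\right]>0,$$ where $$K_{\epsilon,j}=\frac{2\delta_{g,j}}{(\mathbf{u}^U-\mathbf{u}^L)^T\overline{\mathbf{Q}}_j(\mathbf{u}^U-\mathbf{u}^L)},\qquad \boldsymbol{\kappa}_j^T=[\kappa_{j1}\ \cdots\ \kappa_{jn_u}].$$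
   Context: Setting. $\mathcal{I}=\{\mathbf{u}\in\mathbb{R}^{n_u}:\mathbf{u}^L\preceq\mathbf{u}\preceq\mathbf{u}^U\}$ (componentwise inequalities). The functions $g_{p,j}:\mathbb{R}^{n_u}\to\mathbb{R}$, $j=1,\dots,n_g$, are twice continuously differentiable over $\mathcal{I}$, and none of them is constant. The initial point $\mathbf{u}_0\in\mathcal{I}$ is strictly feasible: $g_{p,j}(\mathbf{u}_0)<0$ for all $j$. At each iteration $k\ge0$ the RTO algorithm provides a target $\mathbf{u}^*_{k+1}\in\mathcal{I}$, $\mathbf{u}^*_{k+1}\ne\mathbf{u}_k$, and the next iterate is $\mathbf{u}_{k+1}=\mathbf{u}_k+K_k(\mathbf{u}^*_{k+1}-\mathbf{u}_k)$ with filter gain $K_k\in[0,1]$. Strict Lipschitz constants $\kappa_{ji}$: $-\kappa_{ji}<\frac{\partial g_{p,j}}{\partial u_i}\big|_{\mathbf{u}}<\kappa_{ji}$ for all $\mathbf{u}\in\mathcal{I}$, all $i,j$. Nonstrict Lipschitz constants $\tilde\kappa_{ji}$: $-\tilde\kappa_{ji}\le\frac{\partial g_{p,j}}{\partial u_i}\big|_{\mathbf{u}}\le\tilde\kappa_{ji}$ for all $\mathbf{u}\in\mathcal{I}$, all $i,j$. The degree of strictness of the Lipschitz constants is $\gamma_\kappa=\max_{i,j}\tilde\kappa_{ji}/\kappa_{ji}$ (maximum over $i=1,\dots,n_u$, $j=1,\dots,n_g$); here $\gamma_\kappa\in(0,1)$. Quadratic upper bound $\overline{\mathbf{Q}}_j\succ0$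 of $g_{p,j}$: the diagonal matrix with diagonal entries $\overline{Q}_{j,ii}=\sum_{l=1}^{n_u}M^{(j)}_{il}$, where $M^{(j)}_{il}$ are constants with $-M^{(j)}_{il}<\frac{\partial^2 g_{p,j}}{\partial u_i\partial u_l}\big|_{\mathbf{u}}<M^{(j)}_{il}$ for all $\mathbf{u}\in\mathcal{I}$.
   Formalization: At k = 0, if u_0 and u*_1 are opposite vertices of the box (|u*_{1,i} − u_{0,i}| = u^U_i − u^L_i for all i), only K_0 ≥ the bound is claimed, since the strict inequality can fail there; for all other cases the strict inequality is kept. *)

theory Defs
  imports "HOL-Analysis.Analysis"
begin

definition partial_deriv :: "'n::finite \<Rightarrow> (real^'n \<Rightarrow> real) \<Rightarrow> real^'n \<Rightarrow> real" where
  "partial_deriv i f x = deriv (\<lambda>t. f (x + t *\<^sub>R axis i 1)) 0"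

definition grad :: "(real^'n::finite \<Rightarrow> real) \<Rightarrow> real^'n \<Rightarrow> real^'n" where
  "grad f x = (\<chi> i. partial_deriv i f x)"

text \<open>
  As usual for a set that need not be open, f is twice continuously differentiable over S if it is
  so on some open set containing S. Differentiability of f and of its first partial derivatives
  on that set makes them continuous, so only the second ones need an explicit continuity condition.
\<close>

definition C2_over :: "(real^'n::finite) set \<Rightarrow> (real^'n \<Rightarrow> real) \<Rightarrow> bool" where
  "C2_over S f \<longleftrightarrow> (\<exists>U. open U \<and> S \<subseteq> U \<and> f differentiable_on U \<and>
     (\<forall>i. partial_deriv i f differentiable_on U) \<and>
     (\<forall>i l. continuous_on U (partial_deriv i (partial_deriv l f))))"

definition strictness_degree ::
    "('m::finite \<Rightarrow> real^'n::finite) \<Rightarrow> ('m \<Rightarrow> real^'n) \<Rightarrow> real" where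
  "strictness_degree \<kappa>t \<kappa> = (MAX (i, j)\<in>UNIV. \<kappa>t j $ i / \<kappa> j $ i)"

text \<open>
  If the entries of M strictly bound the absolute values of the entries of a Hessian H, the diagonal
  matrix of the row sums of M dominates H, because 2 |x y| is at most x^2 + y^2 and H is symmetric;
  M itself need not be.
\<close>

definition quad_upper_bound :: "real^'n^'n \<Rightarrow> real^'n::finite^'n" where
  "quad_upper_bound M = (\<chi> i l. if i = l then (\<Sum>r\<in>UNIV. M $ i $ r) else 0)"

text \<open>
  The largest t for which - t \<delta> + (t^2 / 2) (uU - uL)^T Q (uU - uL) is not positive.
\<close>

definition K_eps :: "real^'n::finite \<Rightarrow> real^'n \<Rightarrow> real^'n^'n \<Rightarrow> real \<Rightarrow> real" where
  "K_eps uL uU Q \<delta> = 2 * \<delta> / ((uU - uL) \<bullet> (Q *v (uU - uL)))"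

end

theory Submission
  imports Defs
begin

text \<open>
  Call \<open>- g\<^sub>j(u\<^sub>k)\<close> the slack. Since the gain is built from the strict Lipschitz constants, a
  step shrinks the slack at most by the factor \<open>1 - \<gamma>\<close>. If the constraint is not \<open>\<epsilon>\<^sub>j\<close>-active,
  the new slack exceeds \<open>(1 - \<gamma>) \<epsilon>\<^sub>j\<close>. If it is, then by Taylor's theorem and the quadratic upper
  bound a gain of at most \<open>K\<^sub>\<epsilon>\<^sub>,\<^sub>j\<close> strictly increases the slack. For a larger gain,
  \<open>\<delta>\<^sub>j \<le> \<gamma> s\<close>, where \<open>s\<close> is the denominator in the gain formula, so that the old slack exceeded
  \<open>K\<^sub>\<epsilon>\<^sub>,\<^sub>j \<delta>\<^sub>j / \<gamma>\<close>. Hence the slack never falls below the numerator of the bound and lies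
  strictly above it after the first step; finally \<open>s\<close> is at most \<open>\<kappa>\<^sub>j\<^sup>T (u\<^sup>U - u\<^sup>L)\<close>.
\<close>

section \<open>Gradients and derivatives along lines\<close>

text \<open>Since \<open>grad\<close> is assembled from one-dimensional \<open>deriv\<close>s, it
  has to be tied to the total derivative: along an axis the chain rule identifies the two, and
  linearity extends this to every direction.\<close>

lemma has_derivative_grad:
  assumes "f differentiable at x"
  shows "(f has_derivative (\<lambda>v. grad f x \<bullet> v)) (at x)"
proof -
  from assms obtain F where F: "(f has_derivative F) (at x)"
    by (auto simp: differentiable_def)
  have lin: "linear F"
    using F by (rule has_derivative_linear)
  have pd: "partial_deriv i f x = F (axis i 1)" for i
  proof -
    have "((\<lambda>t. f (x + t *\<^sub>R axis i 1)) has_derivative (\<lambda>t. F (t *\<^sub>R axis i 1))) (at 0)"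
      by (rule has_derivative_compose[where g = f]) (auto intro!: derivative_eq_intros simp: F)
    hence "((\<lambda>t. f (x + t *\<^sub>R axis i 1)) has_field_derivative F (axis i 1)) (at 0)"
      by (simp add: has_field_derivative_def linear_cmul[OF lin] mult_commute_abs)
    thus ?thesis
      unfolding partial_deriv_def by (rule DERIV_imp_deriv)
  qed
  have "F v = grad f x \<bullet> v" for v
  proof -
    have "F v = F (\<Sum>i\<in>UNIV. v $ i *\<^sub>R axis i 1)"
      using basis_expansion[of v] by (simp add: scalar_mult_eq_scaleR)
    also have "\<dots> = (\<Sum>i\<in>UNIV. v $ i * F (axis i 1))"
      by (simp add: linear_sum[OF lin] linear_cmul[OF lin])
    finally show ?thesis
      by (simp add: inner_vec_def grad_def pd mult.commute)
  qed
  hence "F = (\<lambda>v. grad f x \<bullet> v)" by (rule ext)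
  with F show ?thesis by simp
qed

lemma DERIV_along_line:
  assumes "f differentiable at (x + t *\<^sub>R v)"
  shows "((\<lambda>s. f (x + s *\<^sub>R v)) has_field_derivative grad f (x + t *\<^sub>R v) \<bullet> v) (at t)"
proof -
  have "((\<lambda>s. f (x + s *\<^sub>R v)) has_derivative (\<lambda>s. grad f (x + t *\<^sub>R v) \<bullet> (s *\<^sub>R v))) (at t)"
    by (rule has_derivative_compose[where g = f])
      (auto intro!: derivative_eq_intros simp: has_derivative_grad[OF assms])
  thus ?thesis
    by (simp add: has_field_derivative_def mult_commute_abs)
qed

lemma DERIV_along_axis:
  assumes "f differentiable at (x + t *\<^sub>R axis i 1)"
  shows "((\<lambda>s. f (x + s *\<^sub>R axis i 1)) has_field_derivative
    partial_deriv i f (x + t *\<^sub>R axis i 1)) (at t)"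
  using DERIV_along_line[OF assms] by (simp add: inner_axis grad_def)

section \<open>Symmetry of second partial derivatives\<close>

text \<open>The mean value theorem is used twice: along axis \<open>i\<close> for the difference of
  \<open>f\<close> between two parallel edges, then along axis \<open>l\<close> for
  \<open>partial_deriv i f\<close>. The left-hand side is symmetric in \<open>i\<close> and
  \<open>l\<close>, which is what symmetry of the Hessian rests on.\<close>

lemma second_difference_mean_value:
  fixes f :: "real^'n::finite \<Rightarrow> real"
  assumes h: "h > 0"
    and box: "\<And>s t. s \<in> {0..h} \<Longrightarrow> t \<in> {0..h} \<Longrightarrow> a + s *\<^sub>R axis i 1 + t *\<^sub>R axis l 1 \<in> U"
    and f: "\<And>x. x \<in> U \<Longrightarrow> f differentiable at x"
    and fi: "\<And>x. x \<in> U \<Longrightarrow> partial_deriv i f differentiable at x"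
  shows "\<exists>s\<in>{0..h}. \<exists>t\<in>{0..h}.
    f (a + h *\<^sub>R axis i 1 + h *\<^sub>R axis l 1) - f (a + h *\<^sub>R axis i 1) - f (a + h *\<^sub>R axis l 1) + f a
      = h\<^sup>2 * partial_deriv l (partial_deriv i f) (a + s *\<^sub>R axis i 1 + t *\<^sub>R axis l 1)"
proof -
  define b where "b = a + h *\<^sub>R axis l 1"
  have in_U: "a + s *\<^sub>R axis i 1 \<in> U" "b + s *\<^sub>R axis i 1 \<in> U" if "0 \<le> s" "s \<le> h" for s
    using box[of s 0] box[of s h] that h by (simp_all add: b_def add_ac)
  have "\<exists>s>0. s < h \<and>
      (f (b + h *\<^sub>R axis i 1) - f (a + h *\<^sub>R axis i 1)) -
      (f (b + 0 *\<^sub>R axis i 1) - f (a + 0 *\<^sub>R axis i 1)) =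
      (h - 0) * (partial_deriv i f (b + s *\<^sub>R axis i 1) - partial_deriv i f (a + s *\<^sub>R axis i 1))"
    by (rule MVT2[OF h], rule DERIV_diff) (auto intro!: DERIV_along_axis f in_U)
  then obtain s where s: "0 < s" "s < h" and eq_s:
      "(f (b + h *\<^sub>R axis i 1) - f (a + h *\<^sub>R axis i 1)) - (f b - f a) =
       h * (partial_deriv i f (b + s *\<^sub>R axis i 1) - partial_deriv i f (a + s *\<^sub>R axis i 1))"
    by auto
  define c where "c = a + s *\<^sub>R axis i 1"
  have "\<exists>t>0. t < h \<and>
      partial_deriv i f (c + h *\<^sub>R axis l 1) - partial_deriv i f (c + 0 *\<^sub>R axis l 1) =
      (h - 0) * partial_deriv l (partial_deriv i f) (c + t *\<^sub>R axis l 1)"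
    using s box by (intro MVT2[OF h] DERIV_along_axis fi) (auto simp: c_def)
  then obtain t where t: "0 < t" "t < h" and eq_t:
      "partial_deriv i f (c + h *\<^sub>R axis l 1) - partial_deriv i f c =
       h * partial_deriv l (partial_deriv i f) (c + t *\<^sub>R axis l 1)"
    by auto
  have bc: "b + s *\<^sub>R axis i 1 = c + h *\<^sub>R axis l 1"
    and b': "b + h *\<^sub>R axis i 1 = a + h *\<^sub>R axis i 1 + h *\<^sub>R axis l 1"
    by (simp_all add: b_def c_def add_ac)
  have "f (a + h *\<^sub>R axis i 1 + h *\<^sub>R axis l 1) - f (a + h *\<^sub>R axis i 1)
      - f (a + h *\<^sub>R axis l 1) + f a = h * (h * partial_deriv l (partial_deriv i f) (c + t *\<^sub>R axis l 1))"
    using eq_s eq_t unfolding bc b' c_def[symmetric] by (simp add: b_def)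
  with s t show ?thesis
    by (intro bexI[of _ s] bexI[of _ t]) (auto simp: c_def power2_eq_square)
qed

text \<open>Schwarz's argument: one second difference at \<open>x\<close> equals
  \<open>h\<^sup>2\<close> times either mixed derivative at points near \<open>x\<close>, and
  continuity of both lets these points tend to \<open>x\<close>.\<close>

lemma partial_deriv_commute:
  fixes f :: "real^'n::finite \<Rightarrow> real"
  assumes "C2_over S f" and "x \<in> S"
  shows "partial_deriv i (partial_deriv l f) x = partial_deriv l (partial_deriv i f) x"
proof -
  let ?A = "partial_deriv l (partial_deriv i f)" and ?B = "partial_deriv i (partial_deriv l f)"
  from assms obtain U where U: "open U" "x \<in> U"
    and f: "\<And>y. y \<in> U \<Longrightarrow> f differentiable at y"
    and f1: "\<And>i y. y \<in> U \<Longrightarrow> partial_deriv i f differentiable at y"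
    and f2: "\<And>i l. continuous_on U (partial_deriv i (partial_deriv l f))"
    unfolding C2_over_def by (auto simp: differentiable_on_eq_differentiable_at)
  have "\<bar>?A x - ?B x\<bar> \<le> e" if e: "e > 0" for e
  proof -
    have "isCont ?A x" "isCont ?B x"
      using U f2 by (auto simp: continuous_on_eq_continuous_at)
    hence "\<exists>d>0. \<forall>y. dist y x < d \<longrightarrow> dist (?A y) (?A x) < e / 2"
      and "\<exists>d>0. \<forall>y. dist y x < d \<longrightarrow> dist (?B y) (?B x) < e / 2"
      unfolding continuous_at_eps_delta using half_gt_zero[OF e] by blast+
    then obtain d1 d2 where d1: "d1 > 0" "\<And>y. dist y x < d1 \<Longrightarrow> dist (?A y) (?A x) < e / 2"
      and d2: "d2 > 0" "\<And>y. dist y x < d2 \<Longrightarrow> dist (?B y) (?B x) < e / 2"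
      by auto
    obtain d3 where d3: "d3 > 0" "ball x d3 \<subseteq> U"
      using U open_contains_ball by blast
    \<comment> \<open>Two axis moves of length at most \<open>h\<close> end within
      \<open>2 * h\<close> of \<open>x\<close>; dividing by 3 keeps this strictly below all three
      radii.\<close>
    define h where "h = min d1 (min d2 d3) / 3"
    have h: "h > 0" "2 * h < d1" "2 * h < d2" "2 * h < d3"
      using d1(1) d2(1) d3(1) by (auto simp: h_def)
    have near: "dist (x + s *\<^sub>R axis i 1 + t *\<^sub>R axis l 1) x \<le> 2 * h"
      if "s \<in> {0..h}" "t \<in> {0..h}" for s t and i l :: 'n
    proof -
      have "norm (s *\<^sub>R axis i 1 + t *\<^sub>R axis l 1 :: real^'n) \<le> s + t"
        using that by (intro norm_triangle_le) auto
      thus ?thesis using that by (simp add: dist_norm add.assoc)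
    qed
    have box: "x + s *\<^sub>R axis i 1 + t *\<^sub>R axis l 1 \<in> U" if "s \<in> {0..h}" "t \<in> {0..h}" for s t and i l :: 'n
      using near[OF that, of i l] h d3(2) by (auto simp: subset_iff dist_commute)
    obtain s t where st: "s \<in> {0..h}" "t \<in> {0..h}" and A:
      "f (x + h *\<^sub>R axis i 1 + h *\<^sub>R axis l 1) - f (x + h *\<^sub>R axis i 1) - f (x + h *\<^sub>R axis l 1) + f x
        = h\<^sup>2 * ?A (x + s *\<^sub>R axis i 1 + t *\<^sub>R axis l 1)"
      using second_difference_mean_value[OF h(1) box f f1] by blast
    obtain s' t' where st': "s' \<in> {0..h}" "t' \<in> {0..h}" and B:
      "f (x + h *\<^sub>R axis l 1 + h *\<^sub>R axis i 1) - f (x + h *\<^sub>R axis l 1) - f (x + h *\<^sub>R axis i 1) + f x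
        = h\<^sup>2 * ?B (x + s' *\<^sub>R axis l 1 + t' *\<^sub>R axis i 1)"
      using second_difference_mean_value[OF h(1) box f f1] by blast
    have "h\<^sup>2 * ?A (x + s *\<^sub>R axis i 1 + t *\<^sub>R axis l 1) = h\<^sup>2 * ?B (x + s' *\<^sub>R axis l 1 + t' *\<^sub>R axis i 1)"
      unfolding A[symmetric] B[symmetric] by (simp add: add_ac)
    hence "?A (x + s *\<^sub>R axis i 1 + t *\<^sub>R axis l 1) = ?B (x + s' *\<^sub>R axis l 1 + t' *\<^sub>R axis i 1)"
      using h(1) by simp
    moreover have "dist (?A (x + s *\<^sub>R axis i 1 + t *\<^sub>R axis l 1)) (?A x) < e / 2"
      using near[OF st] h by (intro d1) (meson le_less_trans)
    moreover have "dist (?B (x + s' *\<^sub>R axis l 1 + t' *\<^sub>R axis i 1)) (?B x) < e / 2"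
      using near[OF st'] h by (intro d2) (meson le_less_trans)
    ultimately show ?thesis
      unfolding dist_real_def by linarith
  qed
  hence "\<bar>?A x - ?B x\<bar> \<le> 0"
    using field_le_epsilon[of "\<bar>?A x - ?B x\<bar>" 0] by simp
  thus ?thesis by simp
qed

section \<open>Mean value and Taylor expansions on segments\<close>

lemma C2_over_differentiable:
  assumes "C2_over S f" "x \<in> S"
  shows "f differentiable at x" "partial_deriv i f differentiable at x"
  using assms unfolding C2_over_def
  by (auto simp: differentiable_on_eq_differentiable_at)

lemma mean_value_line:
  fixes f :: "real^'n::finite \<Rightarrow> real"
  assumes "C2_over S f" and "t > 0" and "\<And>s. s \<in> {0..t} \<Longrightarrow> x + s *\<^sub>R v \<in> S"
  shows "\<exists>\<xi>\<in>{0..t}. f (x + t *\<^sub>R v) - f x = t * (grad f (x + \<xi> *\<^sub>R v) \<bullet> v)"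
proof -
  have "\<exists>\<xi>>0. \<xi> < t \<and> f (x + t *\<^sub>R v) - f (x + 0 *\<^sub>R v) = (t - 0) * (grad f (x + \<xi> *\<^sub>R v) \<bullet> v)"
    using assms by (intro MVT2 DERIV_along_line C2_over_differentiable(1)[of S]) auto
  thus ?thesis by (auto intro!: bexI)
qed

lemma taylor_line:
  fixes f :: "real^'n::finite \<Rightarrow> real"
  assumes f: "C2_over S f" and t: "t > 0" and S: "\<And>s. s \<in> {0..t} \<Longrightarrow> x + s *\<^sub>R v \<in> S"
  shows "\<exists>\<xi>\<in>{0..t}. f (x + t *\<^sub>R v) = f x + t * (grad f x \<bullet> v) +
    t\<^sup>2 / 2 * (\<Sum>l\<in>UNIV. \<Sum>i\<in>UNIV. v $ l * v $ i * partial_deriv i (partial_deriv l f) (x + \<xi> *\<^sub>R v))"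
proof -
  define H where "H s = (\<Sum>l\<in>UNIV. \<Sum>i\<in>UNIV. v $ l * v $ i * partial_deriv i (partial_deriv l f) (x + s *\<^sub>R v))" for s
  \<comment> \<open>\<open>Maclaurin\<close> expects a sequence of successive derivatives of the
    restriction of \<open>f\<close> to the line: its value, its slope, and the Hessian form
    \<open>H\<close>.\<close>
  define D where "D m s = (if m = 0 then f (x + s *\<^sub>R v)
    else if m = 1 then grad f (x + s *\<^sub>R v) \<bullet> v else H s)" for m :: nat and s
  have D0: "DERIV (D 0) s :> D 1 s" if "s \<in> {0..t}" for s
    unfolding D_def using DERIV_along_line[OF C2_over_differentiable(1)[OF f S[OF that]]] by simp
  have D1: "DERIV (D 1) s :> D 2 s" if "s \<in> {0..t}" for s
  proof -
    have "DERIV (\<lambda>s. \<Sum>l\<in>UNIV. v $ l * partial_deriv l f (x + s *\<^sub>R v)) s :>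
        (\<Sum>l\<in>UNIV. v $ l * (grad (partial_deriv l f) (x + s *\<^sub>R v) \<bullet> v))"
      by (intro DERIV_sum DERIV_cmult DERIV_along_line C2_over_differentiable(2)[OF f S[OF that]])
    moreover have "(\<Sum>l\<in>UNIV. v $ l * (grad (partial_deriv l f) (x + s *\<^sub>R v) \<bullet> v)) = H s"
      by (simp add: H_def inner_vec_def grad_def sum_distrib_left mult_ac)
    moreover have "D 1 = (\<lambda>s. \<Sum>l\<in>UNIV. v $ l * partial_deriv l f (x + s *\<^sub>R v))" "D 2 = H"
      by (auto simp: D_def fun_eq_iff inner_vec_def grad_def mult.commute)
    ultimately show ?thesis by simp
  qed
  have "\<forall>m s. m < 2 \<and> 0 \<le> s \<and> s \<le> t \<longrightarrow> DERIV (D m) s :> D (Suc m) s"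
  proof (intro allI impI)
    fix m :: nat and s assume "m < 2 \<and> 0 \<le> s \<and> s \<le> t"
    thus "DERIV (D m) s :> D (Suc m) s"
      using D0[of s] D1[of s] less_2_cases[of m] by (auto simp: numeral_2_eq_2)
  qed
  from Maclaurin[OF t _ refl this] obtain \<xi> where \<xi>: "0 < \<xi>" "\<xi> < t"
    "D 0 t = (\<Sum>m<2. D m 0 / fact m * t ^ m) + D 2 \<xi> / fact 2 * t\<^sup>2"
    by auto
  have "f (x + t *\<^sub>R v) = f x + t * (grad f x \<bullet> v) + t\<^sup>2 / 2 * H \<xi>"
    using \<xi>(3) by (simp add: D_def numeral_2_eq_2 mult.commute)
  with \<xi>(1,2) show ?thesis
    unfolding H_def by (intro bexI[of _ \<xi>]) auto
qed

section \<open>The quadratic upper bound\<close>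

lemma inner_quad_upper_bound:
  "v \<bullet> (quad_upper_bound M *v v) = (\<Sum>i\<in>UNIV. \<Sum>l\<in>UNIV. M $ i $ l * (v $ i)\<^sup>2)"
proof -
  have "(quad_upper_bound M *v v) $ i = (\<Sum>l\<in>UNIV. M $ i $ l) * v $ i" for i
    by (simp add: quad_upper_bound_def matrix_vector_mult_def if_distrib if_distribR cong: if_cong)
  thus ?thesis
    by (simp add: inner_vec_def sum_distrib_left sum_distrib_right power2_eq_square mult_ac)
qed

text \<open>Each mixed term is split by 2 |x y| \<le> x^2 + y^2 into a half for its row and a half
  for its column. Symmetry of \<open>H\<close> turns the column halves into row halves, so only row
  sums remain.\<close>

lemma quadratic_form_less_quad_upper_bound:
  fixes H :: "'n::finite \<Rightarrow> 'n \<Rightarrow> real"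
  assumes sym: "\<And>i l. H i l = H l i" and bd: "\<And>i l. \<bar>H i l\<bar> < M $ i $ l" and v: "v \<noteq> 0"
  shows "(\<Sum>i\<in>UNIV. \<Sum>l\<in>UNIV. v $ i * v $ l * H i l) < v \<bullet> (quad_upper_bound M *v v)"
proof -
  let ?S = "\<Sum>i\<in>UNIV. \<Sum>l\<in>UNIV. \<bar>H i l\<bar> * (v $ i)\<^sup>2"
  have le: "v $ i * v $ l * H i l \<le> (\<bar>H i l\<bar> * (v $ i)\<^sup>2 + \<bar>H i l\<bar> * (v $ l)\<^sup>2) / 2" for i l
  proof -
    have "v $ i * v $ l * H i l \<le> \<bar>v $ i * v $ l\<bar> * \<bar>H i l\<bar>"
      by (metis abs_ge_self abs_mult)
    also have "\<bar>v $ i * v $ l\<bar> \<le> ((v $ i)\<^sup>2 + (v $ l)\<^sup>2) / 2"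
      using sum_squares_bound[of "\<bar>v $ i\<bar>" "\<bar>v $ l\<bar>"] by (simp add: abs_mult)
    finally show ?thesis
      by (simp add: mult_right_mono algebra_simps)
  qed
  have swap: "(\<Sum>i\<in>UNIV. \<Sum>l\<in>UNIV. \<bar>H i l\<bar> * (v $ l)\<^sup>2) = ?S"
    by (subst sum.swap) (simp add: sym)
  have "(\<Sum>i\<in>UNIV. \<Sum>l\<in>UNIV. v $ i * v $ l * H i l)
      \<le> (\<Sum>i\<in>UNIV. \<Sum>l\<in>UNIV. (\<bar>H i l\<bar> * (v $ i)\<^sup>2 + \<bar>H i l\<bar> * (v $ l)\<^sup>2) / 2)"
    by (intro sum_mono le)
  also have "\<dots> = ?S"
    using swap by (simp add: sum.distrib sum_divide_distrib[symmetric])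
  also have "\<dots> < (\<Sum>i\<in>UNIV. \<Sum>l\<in>UNIV. M $ i $ l * (v $ i)\<^sup>2)"
  proof -
    \<comment> \<open>A single nonzero coordinate makes its row strict; all other rows only need the
      weak inequality.\<close>
    obtain p where p: "v $ p \<noteq> 0"
      using v by (auto simp: vec_eq_iff)
    show ?thesis
    proof (rule sum_strict_mono_ex1)
      show "\<forall>i\<in>UNIV. (\<Sum>l\<in>UNIV. \<bar>H i l\<bar> * (v $ i)\<^sup>2) \<le> (\<Sum>l\<in>UNIV. M $ i $ l * (v $ i)\<^sup>2)"
        using bd by (auto intro!: sum_mono mult_right_mono simp: less_imp_le)
      show "\<exists>i\<in>UNIV. (\<Sum>l\<in>UNIV. \<bar>H i l\<bar> * (v $ i)\<^sup>2) < (\<Sum>l\<in>UNIV. M $ i $ l * (v $ i)\<^sup>2)"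
        using bd p by (intro bexI[of _ p] sum_strict_mono mult_strict_right_mono) auto
    qed auto
  qed
  finally show ?thesis by (simp add: inner_quad_upper_bound)
qed


section \<open>One step and one constraint\<close>

lemma abs_diff_le_box_width:
  fixes a b :: "real^'n::finite"
  assumes "x \<in> cbox a b" "y \<in> cbox a b"
  shows "\<bar>y $ i - x $ i\<bar> \<le> (b - a) $ i"
  using assms[unfolded mem_box_cart] by (simp add: abs_le_iff) (smt (verit))

lemma segment_in_cbox:
  fixes a b :: "real^'n::finite"
  assumes "x \<in> cbox a b" "y \<in> cbox a b" "0 \<le> t" "t \<le> 1"
  shows "x + t *\<^sub>R (y - x) \<in> cbox a b"
proof -
  have "(1 - t) *\<^sub>R x + t *\<^sub>R y \<in> cbox a b"
    using assms convex_box(1)[of a b] by (intro convexD_alt) auto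
  thus ?thesis by (simp add: algebra_simps)
qed

lemma abs_grad_inner_le:
  assumes "\<And>i. \<bar>partial_deriv i f z\<bar> \<le> \<gamma> * \<kappa> $ i"
  shows "\<bar>grad f z \<bullet> v\<bar> \<le> \<gamma> * (\<Sum>i\<in>UNIV. \<kappa> $ i * \<bar>v $ i\<bar>)"
proof -
  have "\<bar>grad f z \<bullet> v\<bar> \<le> (\<Sum>i\<in>UNIV. \<bar>partial_deriv i f z * v $ i\<bar>)"
    by (simp add: inner_vec_def grad_def sum_abs)
  also have "\<dots> \<le> (\<Sum>i\<in>UNIV. (\<gamma> * \<kappa> $ i) * \<bar>v $ i\<bar>)"
    by (intro sum_mono) (auto simp: abs_mult intro!: mult_right_mono assms)
  finally show ?thesis by (simp add: sum_distrib_left mult.assoc)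
qed

text \<open>The gain caps the step, measured with the weights \<open>\<kappa>\<close>, by the slack.
  True slopes are at most \<gamma> times these weights, so at most the fraction \<gamma> of the
  slack is consumed.\<close>

lemma slack_contraction:
  assumes f: "C2_over (cbox a b) f" and x: "x \<in> cbox a b" and y: "y \<in> cbox a b"
    and t: "0 < t" "t \<le> 1" and \<gamma>: "0 \<le> \<gamma>"
    and lip: "\<And>i z. z \<in> cbox a b \<Longrightarrow> \<bar>partial_deriv i f z\<bar> \<le> \<gamma> * \<kappa> $ i"
    and gain: "t * (\<Sum>i\<in>UNIV. \<kappa> $ i * \<bar>y $ i - x $ i\<bar>) \<le> - f x"
  shows "f (x + t *\<^sub>R (y - x)) \<le> (1 - \<gamma>) * f x"
proof -
  have seg: "x + s *\<^sub>R (y - x) \<in> cbox a b" if "s \<in> {0..t}" for s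
    using that t by (intro segment_in_cbox x y) auto
  obtain \<xi> where \<xi>: "\<xi> \<in> {0..t}"
    and eq: "f (x + t *\<^sub>R (y - x)) - f x = t * (grad f (x + \<xi> *\<^sub>R (y - x)) \<bullet> (y - x))"
    using mean_value_line[OF f t(1) seg] by blast
  have "grad f (x + \<xi> *\<^sub>R (y - x)) \<bullet> (y - x) \<le> \<gamma> * (\<Sum>i\<in>UNIV. \<kappa> $ i * \<bar>y $ i - x $ i\<bar>)"
    using abs_grad_inner_le[OF lip[OF seg[OF \<xi>]], of "y - x"] by simp
  hence "f (x + t *\<^sub>R (y - x)) - f x \<le> t * (\<gamma> * (\<Sum>i\<in>UNIV. \<kappa> $ i * \<bar>y $ i - x $ i\<bar>))"
    using t unfolding eq by simp
  also have "\<dots> \<le> \<gamma> * - f x"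
    using mult_left_mono[OF gain \<gamma>] by (simp add: mult_ac)
  finally show ?thesis by (simp add: algebra_simps)
qed

text \<open>
  The three alternatives: before the step the constraint was not \<open>\<epsilon>\<close>-active; it was, but the
  gain exceeded \<open>K_eps\<close>, which the gain bound allows only at a distance from the boundary; or the
  gain was so small that the descent condition outweighs the curvature.
\<close>

lemma slack_after_step:
  assumes f: "C2_over (cbox a b) f" and x: "x \<in> cbox a b" and y: "y \<in> cbox a b" and xy: "y \<noteq> x"
    and t: "0 < t" "t \<le> 1" and \<gamma>: "0 < \<gamma>" "\<gamma> < 1" and \<delta>: "0 < \<delta>"
    and lip: "\<And>i z. z \<in> cbox a b \<Longrightarrow> \<bar>partial_deriv i f z\<bar> \<le> \<gamma> * \<kappa> $ i"
    and hess: "\<And>i l z. z \<in> cbox a b \<Longrightarrow> \<bar>partial_deriv i (partial_deriv l f) z\<bar> < M $ i $ l"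
    and gain: "t * (\<Sum>i\<in>UNIV. \<kappa> $ i * \<bar>y $ i - x $ i\<bar>) \<le> - f x"
    and descent: "- \<epsilon> \<le> f x \<Longrightarrow> grad f x \<bullet> (y - x) \<le> - \<delta>"
  shows "(1 - \<gamma>) * \<epsilon> < - f (x + t *\<^sub>R (y - x)) \<or>
    (1 - \<gamma>) * (K_eps a b (quad_upper_bound M) \<delta> * \<delta> / \<gamma>) < - f (x + t *\<^sub>R (y - x)) \<or>
    - f x < - f (x + t *\<^sub>R (y - x))"
proof -
  let ?x' = "x + t *\<^sub>R (y - x)"
  let ?s = "\<Sum>i\<in>UNIV. \<kappa> $ i * \<bar>y $ i - x $ i\<bar>"
  let ?q = "(b - a) \<bullet> (quad_upper_bound M *v (b - a))"
  have contr: "(1 - \<gamma>) * - f x \<le> - f ?x'"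
    using slack_contraction[OF f x y t _ lip gain] \<gamma> by simp
  have seg: "x + s *\<^sub>R (y - x) \<in> cbox a b" if "s \<in> {0..t}" for s
    using that t by (intro segment_in_cbox x y) auto
  have hess_form: "(\<Sum>l\<in>UNIV. \<Sum>i\<in>UNIV. (y - x) $ l * (y - x) $ i *
      partial_deriv i (partial_deriv l f) z) < ?q" if z: "z \<in> cbox a b" for z
  proof -
    have "(\<Sum>l\<in>UNIV. \<Sum>i\<in>UNIV. (y - x) $ l * (y - x) $ i * partial_deriv i (partial_deriv l f) z)
        < (y - x) \<bullet> (quad_upper_bound M *v (y - x))"
    proof (rule quadratic_form_less_quad_upper_bound)
      \<comment> \<open>In Taylor's form the row index belongs to the inner derivative, in
        \<open>hess\<close> to the outer one. Commutation aligns them, as \<open>M\<close> may be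
        asymmetric.\<close>
      show "\<bar>partial_deriv l (partial_deriv i f) z\<bar> < M $ i $ l" for i l
        using hess[OF z, of i l] partial_deriv_commute[OF f z, of i l] by simp
    qed (use xy partial_deriv_commute[OF f z] in auto)
    also have "\<dots> \<le> ?q"
    proof -
      \<comment> \<open>Entries bounding absolute values are nonnegative, so the diagonal form grows
        with each squared coordinate, and these are at most the squared box widths.\<close>
      have "0 \<le> M $ i $ l" for i l
        using hess[OF x, of i l] by linarith
      moreover have "((y - x) $ i)\<^sup>2 \<le> ((b - a) $ i)\<^sup>2" for i
        using abs_diff_le_box_width[OF x y, of i] by (simp add: abs_le_square_iff[symmetric])
      ultimately show ?thesis
        unfolding inner_quad_upper_bound by (intro sum_mono mult_left_mono)
    qed
    finally show ?thesis .
  qed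
  consider "f x < - \<epsilon>" | "- \<epsilon> \<le> f x" "K_eps a b (quad_upper_bound M) \<delta> < t"
    | "- \<epsilon> \<le> f x" "t \<le> K_eps a b (quad_upper_bound M) \<delta>" by linarith
  thus ?thesis
  proof cases
    case 1
    hence "(1 - \<gamma>) * \<epsilon> < (1 - \<gamma>) * - f x"
      using \<gamma> by (intro mult_strict_left_mono) auto
    with contr show ?thesis by linarith
  next
    case 2
    \<comment> \<open>A descent slope of at least \<open>\<delta>\<close> in size must fit under the
      Lipschitz bound, so the target cannot be too close.\<close>
    have "\<delta> \<le> \<gamma> * ?s"
      using abs_grad_inner_le[OF lip[OF x], of "y - x"] descent[OF 2(1)] by simp
    hence s: "\<delta> / \<gamma> \<le> ?s"
      using \<gamma> by (simp add: divide_le_eq mult.commute)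
    have "K_eps a b (quad_upper_bound M) \<delta> * (\<delta> / \<gamma>) < t * (\<delta> / \<gamma>)"
      using 2 \<gamma> \<delta> by (intro mult_strict_right_mono) auto
    also have "\<dots> \<le> t * ?s"
      using s t by (intro mult_left_mono) auto
    also have "\<dots> \<le> - f x" by (rule gain)
    finally have "(1 - \<gamma>) * (K_eps a b (quad_upper_bound M) \<delta> * \<delta> / \<gamma>) < (1 - \<gamma>) * - f x"
      using \<gamma> by (intro mult_strict_left_mono) auto
    with contr show ?thesis by linarith
  next
    case 3
    obtain \<xi> where \<xi>: "\<xi> \<in> {0..t}" and eq: "f ?x' = f x + t * (grad f x \<bullet> (y - x)) +
        t\<^sup>2 / 2 * (\<Sum>l\<in>UNIV. \<Sum>i\<in>UNIV. (y - x) $ l * (y - x) $ i *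
          partial_deriv i (partial_deriv l f) (x + \<xi> *\<^sub>R (y - x)))"
      using taylor_line[OF f t(1) seg] by blast
    have "f ?x' < f x + t * (grad f x \<bullet> (y - x)) + t\<^sup>2 / 2 * ?q"
      unfolding eq using t hess_form[OF seg[OF \<xi>]] by simp
    also have "\<dots> \<le> f x + t * (- \<delta>) + t\<^sup>2 / 2 * ?q"
      using mult_left_mono[OF descent[OF 3(1)], of t] t by simp
    also have "\<dots> \<le> f x"
    proof -
      \<comment> \<open>Positivity follows from the case assumption: if \<open>?q \<le> 0\<close>,
        including \<open>?q = 0\<close> where division yields 0, then \<open>K_eps\<close> would be
        at most 0, yet \<open>0 < t\<close>.\<close>
      have "0 < ?q"
      proof (rule ccontr)
        assume "\<not> ?thesis"
        hence "K_eps a b (quad_upper_bound M) \<delta> \<le> 0"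
          unfolding K_eps_def using \<delta> by (intro divide_nonneg_nonpos) auto
        with 3(2) t show False by linarith
      qed
      hence "t * ?q \<le> 2 * \<delta>"
        using 3(2) by (simp add: K_eps_def le_divide_eq)
      hence "t * (t * ?q) \<le> t * (2 * \<delta>)"
        using t by simp
      thus ?thesis by (simp add: power2_eq_square)
    qed
    finally show ?thesis by simp
  qed
qed

section \<open>All constraints and all iterations\<close>

lemma strictness_degree_bound:
  assumes "0 < \<kappa> j $ i"
  shows "\<kappa>t j $ i \<le> strictness_degree \<kappa>t \<kappa> * \<kappa> j $ i"
proof -
  have "\<kappa>t j $ i / \<kappa> j $ i \<le> strictness_degree \<kappa>t \<kappa>"
    unfolding strictness_degree_def by (rule Max_ge) (auto intro!: image_eqI[of _ _ "(i, j)"])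
  with assms show ?thesis by (simp add: divide_le_eq)
qed

text \<open>The case distinction isolates a possible equality: if the first target lies a full box
  width away in every coordinate, then \<open>s 0 j\<close> equals the denominator of the bound, and
  its numerator may be \<open>- g j (u 0)\<close> itself.\<close>

theorem theorem3:
  fixes g :: "'m::finite \<Rightarrow> real^'n::finite \<Rightarrow> real"
    and uL uU :: "real^'n"
    and u ustar :: "nat \<Rightarrow> real^'n"
    and K :: "nat \<Rightarrow> real"
    and \<kappa> \<kappa>t :: "'m \<Rightarrow> real^'n"
    and M :: "'m \<Rightarrow> real^'n^'n"
    and \<epsilon> \<delta> :: "'m \<Rightarrow> real"
    and \<gamma> :: real
  assumes g_C2: "\<And>j. C2_over (cbox uL uU) (g j)"
    and g_nonconst: "\<And>j. \<not> g j constant_on UNIV"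
    and u0_box: "u 0 \<in> cbox uL uU"
    and u0_feasible: "\<And>j. g j (u 0) < 0"
    and target_box: "\<And>k. ustar (Suc k) \<in> cbox uL uU"
    and target_neq: "\<And>k. ustar (Suc k) \<noteq> u k"
    and iterate: "\<And>k. u (Suc k) = u k + K k *\<^sub>R (ustar (Suc k) - u k)"
    and gain_range: "\<And>k. K k \<in> {0..1}"
    and lipschitz_strict: "\<And>i j x. x \<in> cbox uL uU \<Longrightarrow>
          - \<kappa> j $ i < partial_deriv i (g j) x \<and> partial_deriv i (g j) x < \<kappa> j $ i"
    and lipschitz_nonstrict: "\<And>i j x. x \<in> cbox uL uU \<Longrightarrow>
          - \<kappa>t j $ i \<le> partial_deriv i (g j) x \<and> partial_deriv i (g j) x \<le> \<kappa>t j $ i"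
    and \<gamma>_def: "\<gamma> = strictness_degree \<kappa>t \<kappa>"
    and \<gamma>_range: "\<gamma> \<in> {0<..<1}"
    and hessian_bound: "\<And>i l j x. x \<in> cbox uL uU \<Longrightarrow>
          - M j $ i $ l < partial_deriv i (partial_deriv l (g j)) x \<and>
          partial_deriv i (partial_deriv l (g j)) x < M j $ i $ l"
    and gain: "\<And>k. K k =
          (MIN j. - g j (u k) / (\<Sum>i\<in>UNIV. \<kappa> j $ i * \<bar>ustar (Suc k) $ i - u k $ i\<bar>))"
    and \<epsilon>_pos: "\<And>j. \<epsilon> j > 0"
    and \<delta>_pos: "\<And>j. \<delta> j > 0"
    and descent: "\<And>k j. g j (u k) \<ge> - \<epsilon> j \<Longrightarrow>
          grad (g j) (u k) \<bullet> (ustar (Suc k) - u k) \<le> - \<delta> j"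
  defines "K_low \<equiv> (MIN j. Min {(1 - \<gamma>) * \<epsilon> j,
          (1 - \<gamma>) * (K_eps uL uU (quad_upper_bound (M j)) (\<delta> j) * \<delta> j / \<gamma>),
          - g j (u 0)} / (\<kappa> j \<bullet> (uU - uL)))"
  shows "(\<forall>k. if k = 0 \<and> (\<forall>i. \<bar>ustar (Suc k) $ i - u k $ i\<bar> = uU $ i - uL $ i)
            then K k \<ge> K_low else K k > K_low) \<and> K_low > 0"
proof -
  let ?w = "uU - uL"
  define m where "m j = Min {(1 - \<gamma>) * \<epsilon> j,
    (1 - \<gamma>) * (K_eps uL uU (quad_upper_bound (M j)) (\<delta> j) * \<delta> j / \<gamma>), - g j (u 0)}" for j
  define s where "s k j = (\<Sum>i\<in>UNIV. \<kappa> j $ i * \<bar>ustar (Suc k) $ i - u k $ i\<bar>)" for k j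
  have K_low: "K_low = (MIN j. m j / (\<kappa> j \<bullet> ?w))"
    by (simp add: K_low_def m_def)
  have gain': "K k = (MIN j. - g j (u k) / s k j)" for k
    by (simp add: gain s_def)
  have \<gamma>: "0 < \<gamma>" "\<gamma> < 1"
    using \<gamma>_range by auto
  have \<kappa>_pos: "0 < \<kappa> j $ i" for i j
    using lipschitz_strict[OF u0_box, of j i] by linarith
  have M_pos: "0 < M j $ i $ l" for i j l
    using hessian_bound[OF u0_box, of j i l] by linarith
  have lip: "\<bar>partial_deriv i (g j) z\<bar> \<le> \<gamma> * \<kappa> j $ i" if "z \<in> cbox uL uU" for i j z
    using lipschitz_nonstrict[OF that, of j i] strictness_degree_bound[of \<kappa> j i \<kappa>t] \<kappa>_pos[of j i]
    unfolding \<gamma>_def by linarith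
  have hess: "\<bar>partial_deriv i (partial_deriv l (g j)) z\<bar> < M j $ i $ l" if "z \<in> cbox uL uU" for i j l z
    using hessian_bound[OF that, of j i l] by linarith

  have u_box: "u k \<in> cbox uL uU" for k
  proof (induction k)
    case (Suc k)
    thus ?case
      using gain_range[of k] target_box[of k] by (simp add: iterate segment_in_cbox)
  qed (rule u0_box)
  have width: "\<bar>ustar (Suc k) $ i - u k $ i\<bar> \<le> ?w $ i" for k i
    by (rule abs_diff_le_box_width[OF u_box target_box])
  have s_pos: "0 < s k j" for k j
  proof -
    obtain p where "ustar (Suc k) $ p \<noteq> u k $ p"
      using target_neq[of k] by (auto simp: vec_eq_iff)
    thus ?thesis
      unfolding s_def using \<kappa>_pos
      by (intro sum_pos2[of _ p]) (auto intro!: mult_nonneg_nonneg intro: less_imp_le)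
  qed
  have s_le: "s k j \<le> \<kappa> j \<bullet> ?w" for k j
    unfolding s_def inner_vec_def inner_real_def
    by (intro sum_mono mult_left_mono width) (auto intro: less_imp_le \<kappa>_pos)
  have s_less: "s k j < \<kappa> j \<bullet> ?w"
    if "\<bar>ustar (Suc k) $ p - u k $ p\<bar> \<noteq> uU $ p - uL $ p" for k j p
    unfolding s_def inner_vec_def inner_real_def
  proof (rule sum_strict_mono_ex1)
    show "\<forall>i\<in>UNIV. \<kappa> j $ i * \<bar>ustar (Suc k) $ i - u k $ i\<bar> \<le> \<kappa> j $ i * ?w $ i"
      by (intro ballI mult_left_mono width) (auto intro: less_imp_le \<kappa>_pos)
    have "\<bar>ustar (Suc k) $ p - u k $ p\<bar> < ?w $ p"
      using width[of k p] that by simp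
    thus "\<exists>i\<in>UNIV. \<kappa> j $ i * \<bar>ustar (Suc k) $ i - u k $ i\<bar> < \<kappa> j $ i * ?w $ i"
      using \<kappa>_pos by (auto intro!: exI[of _ p])
  qed simp
  \<comment> \<open>The box may be flat in some coordinates but not in all, because the first target
    differs from \<open>u 0\<close>.\<close>
  have \<kappa>w_pos: "0 < \<kappa> j \<bullet> ?w" for j
    using s_pos[of 0 j] s_le[of 0 j] by linarith

  have m_pos: "0 < m j" for j
  proof -
    \<comment> \<open>A nonzero box width makes the denominator of \<open>K_eps\<close> positive, so
      \<open>K_eps\<close> is positive too.\<close>
    have "\<exists>p. ?w $ p \<noteq> 0"
      using \<kappa>w_pos[of j] by (auto simp: inner_vec_def intro: ccontr)
    then obtain p where p: "?w $ p \<noteq> 0" ..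
    have "0 < ?w \<bullet> (quad_upper_bound (M j) *v ?w)"
      unfolding inner_quad_upper_bound using p M_pos
      by (intro sum_pos2[of _ p] sum_pos sum_nonneg) (auto simp: less_imp_le)
    thus ?thesis
      unfolding m_def using \<gamma> \<epsilon>_pos[of j] \<delta>_pos[of j] u0_feasible[of j] by (simp add: K_eps_def)
  qed
  have m_0: "m j \<le> - g j (u 0)" for j
    by (simp add: m_def)
  \<comment> \<open>Strictness starts only at \<open>k = 1\<close>, as \<open>m j\<close> can equal
    the initial slack. The index \<open>j\<close> is generalized because a positive gain requires
    positive slack in every constraint.\<close>
  have slack: "m j \<le> - g j (u k) \<and> (0 < k \<longrightarrow> m j < - g j (u k))" for j k
  proof (induction k arbitrary: j)
    case 0
    show ?case by (simp add: m_0)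
  next
    case (Suc k)
    have "0 < - g j (u k)" for j
      using Suc.IH[of j] m_pos[of j] by linarith
    hence "0 < - g j (u k) / s k j" for j
      using s_pos by (intro divide_pos_pos)
    hence K_pos: "0 < K k"
      unfolding gain' by simp
    have "K k \<le> - g j (u k) / s k j"
      unfolding gain' by (rule Min_le) auto
    hence gain_j: "K k * s k j \<le> - g j (u k)"
      using s_pos[of k j] by (simp only: pos_le_divide_eq)
    have "(1 - \<gamma>) * \<epsilon> j < - g j (u (Suc k)) \<or>
        (1 - \<gamma>) * (K_eps uL uU (quad_upper_bound (M j)) (\<delta> j) * \<delta> j / \<gamma>) < - g j (u (Suc k)) \<or>
        - g j (u k) < - g j (u (Suc k))"
      unfolding iterate using gain_range[of k]
      by (intro slack_after_step[OF g_C2 u_box target_box target_neq K_pos _ \<gamma> \<delta>_pos lip hess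
            gain_j[unfolded s_def] descent]) auto
    moreover have "m j \<le> (1 - \<gamma>) * \<epsilon> j"
      "m j \<le> (1 - \<gamma>) * (K_eps uL uU (quad_upper_bound (M j)) (\<delta> j) * \<delta> j / \<gamma>)"
      by (simp_all add: m_def)
    \<comment> \<open>In the third alternative the slack has strictly grown, so the weak bound from
      the induction hypothesis becomes strict.\<close>
    ultimately have "m j < - g j (u (Suc k))"
      using Suc.IH[of j] by linarith
    thus ?case by simp
  qed

  have K_low_le: "K_low \<le> m j / (\<kappa> j \<bullet> ?w)" for j
    unfolding K_low by (rule Min_le) auto
  \<comment> \<open>It suffices to compare quotients at an index where the gain attains its minimum,
    since \<open>K_low\<close> lies below the quotient of every index.\<close>
  have K_attained: "\<exists>j. K k = - g j (u k) / s k j" for k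
  proof -
    have "K k \<in> range (\<lambda>j. - g j (u k) / s k j)"
      unfolding gain' by (rule Min_in) auto
    thus ?thesis by blast
  qed
  have le: "K_low \<le> K k" for k
  proof -
    obtain j where "K k = - g j (u k) / s k j"
      using K_attained by blast
    moreover have "m j / (\<kappa> j \<bullet> ?w) \<le> - g j (u k) / s k j"
      using slack[of j k] m_pos[of j] s_pos s_le by (intro frac_le) auto
    ultimately show ?thesis using K_low_le[of j] by linarith
  qed
  have less: "K_low < K k"
    if not_full: "\<not> (k = 0 \<and> (\<forall>i. \<bar>ustar (Suc k) $ i - u k $ i\<bar> = uU $ i - uL $ i))" for k
  proof -
    obtain j where "K k = - g j (u k) / s k j"
      using K_attained by blast
    \<comment> \<open>Strictness has two sources: at \<open>k = 0\<close> the smaller denominator,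
      when some coordinate uses less than the full width; later the larger numerator.\<close>
    moreover have "m j / (\<kappa> j \<bullet> ?w) < - g j (u k) / s k j"
    proof (cases "k = 0")
      case True
      then obtain p where "\<bar>ustar (Suc k) $ p - u k $ p\<bar> \<noteq> uU $ p - uL $ p"
        using not_full by blast
      thus ?thesis
        using slack[of j k] m_pos[of j] s_pos[of k j] s_less[of k p j] by (intro frac_less2) auto
    next
      case False
      thus ?thesis
        using slack[of j k] m_pos[of j] s_pos[of k j] s_le[of k j] by (intro frac_less) auto
    qed
    ultimately show ?thesis using K_low_le[of j] by linarith
  qed
  have "0 < K_low"
    unfolding K_low using m_pos \<kappa>w_pos by simp
  with le less show ?thesis by auto
qed

end
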